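(* Let $n\ge 1$ and let $x_1,\dots,x_n\in\mathbb{R}^n$ be linearly independent unit vectors. Let $X$ be the real $n\times n$ matrix whose $j$-th row is $x_j$, and let $\lambda_1,\dots,\lambda_n$ denote the eigenvalues (with multiplicity) of the Gram matrix $XX^{\ast}$. Then $$\max_{\|y\|=1}\prod_{j=1}^{n}|(Xy)_j|\ \ge\ \left(\frac{n}{\lambda_1^{-1}+\cdots+\lambda_n^{-1}}\right)^{n/2}\cdot n^{-n/2},$$ where the maximum is over unit vectors $y\in\mathbb{R}^n$.
   Context: $\mathbb{R}^n$ carries the standard inner product $\langle\cdot,\cdot\rangle$ and Euclidean norm $\|\cdot\|$. $X^{\ast}$ is the transpose of $X$, so $XX^{\ast}=[\langle x_i,x_j\rangle]_{i,j}$ is the Gram matrix of $x_1,\dots,x_n$, and $(Xy)_j=\langle x_j,y\rangle$. *)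

theory Defs
  imports
    "HOL-Analysis.Analysis"
    "HOL-Computational_Algebra.Computational_Algebra"
begin

definition charpoly :: "'a::comm_ring_1^'n^'n \<Rightarrow> 'a poly" where
  "charpoly A = det (mat [:0, 1:] - map_matrix (\<lambda>a. [:a:]) A)"

text \<open>
  The family \<open>lam\<close> enumerates the eigenvalues of \<open>A\<close>, each one repeated according to its
  multiplicity as a root of the characteristic polynomial. The order of the enumeration is
  arbitrary.
\<close>

definition eigenvalues_with_multiplicity :: "real^'n^'n \<Rightarrow> ('n \<Rightarrow> real) \<Rightarrow> bool" where
  "eigenvalues_with_multiplicity A lam \<longleftrightarrow> charpoly A = (\<Prod>j\<in>UNIV. [:- lam j, 1:])"

lemma poly_charpoly: "poly (charpoly A) t = det (mat t - A)"
proof -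
  have entry: "poly ((mat [:0, 1:] - map_matrix (\<lambda>a. [:a:]) A) $ i $ j) t = (mat t - A) $ i $ j"
    for i j
    by (simp add: mat_def)
  show ?thesis
    unfolding charpoly_def det_def
    by (simp only: poly_sum poly_mult poly_prod entry poly_of_int)
qed

lemma eigenvalues_with_multiplicity_range:
  fixes A :: "real^'n^'n"
  assumes "eigenvalues_with_multiplicity A lam"
  shows "range lam = {t. \<exists>v. v \<noteq> 0 \<and> A *v v = t *s v}"
proof -
  have "t \<in> range lam \<longleftrightarrow> (\<exists>v. v \<noteq> 0 \<and> A *v v = t *s v)" for t
  proof -
    have "t \<in> range lam \<longleftrightarrow> poly (charpoly A) t = 0"
      using assms by (auto simp: eigenvalues_with_multiplicity_def poly_prod)
    also have "\<dots> \<longleftrightarrow> det (mat t - A) = 0"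
      by (simp add: poly_charpoly)
    also have "\<dots> \<longleftrightarrow> (\<exists>v. v \<noteq> 0 \<and> (mat t - A) *v v = 0)"
      by (metis invertible_det_nz invertible_left_inverse matrix_left_invertible_ker)
    also have "\<dots> \<longleftrightarrow> (\<exists>v. v \<noteq> 0 \<and> A *v v = t *s v)"
    proof -
      have "mat t *v v = t *s v" for v :: "real^'n"
        by (simp add: vec_eq_iff matrix_vector_mult_def mat_def if_distrib if_distribR
            cong: if_cong)
      then show ?thesis
        by (auto simp: matrix_vector_mult_diff_rdistrib)
    qed
    finally show ?thesis .
  qed
  then show ?thesis by blast
qed

end

theory Submission
  imports Defs
begin

text \<open>
  Put \<open>Y = X\<inverse>\<close>. For a vector \<open>\<epsilon>\<close> of signs, all coordinates of \<open>X (Y \<epsilon>) = \<epsilon>\<close> have modulus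
  \<open>1\<close>, so normalising \<open>Y \<epsilon>\<close> gives a unit vector at which the product equals
  \<open>\<parallel>Y \<epsilon>\<parallel>\<close> to the power \<open>-n\<close>. It remains to choose the signs so that \<open>Y \<epsilon>\<close> is short.
  As \<open>Y \<epsilon>\<close> is the signed sum of the columns of \<open>Y\<close>, suitable signs give
  \<open>\<parallel>Y \<epsilon>\<parallel>\<^sup>2 \<le> (\<Sum>j. \<parallel>column j Y\<parallel>\<^sup>2)\<close> (lemma \<open>short_signed_sum\<close>).

  The right-hand side is the trace of \<open>transpose Y ** Y\<close>, the inverse of the Gram matrix, and so
  equals \<open>S = (\<Sum>j. inverse (lam j))\<close> (lemma \<open>trace_inverse_eq_sum_inverse_eigenvalues\<close>).
  Hence the product reaches the value \<open>S powr (-n/2)\<close>, which is the claimed bound.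
  The eigenvalue identity is obtained from the characteristic polynomial alone, by
  comparing derivatives at \<open>0\<close> in \<open>det (mat 1 - t *\<^sub>R B) = (\<Prod>j. 1 - t * inverse (lam j))\<close>,
  where \<open>B\<close> is the inverse matrix.
\<close>

text \<open>
  In the Leibniz expansion, a permutation other than the identity moves at least two indices,
  so its term has at least two factors that vanish at \<open>0\<close> and contributes nothing to the
  derivative.
\<close>

lemma has_field_derivative_det_at_identity:
  fixes B :: "real^'n^'n"
  shows "((\<lambda>t. det (mat 1 - t *\<^sub>R B)) has_field_derivative - trace B) (at 0)"
proof -
  let ?f = "\<lambda>p i t. (mat 1 - t *\<^sub>R B) $ i $ p i"
  let ?d = "\<lambda>p. \<Sum>i\<in>UNIV. - B $ i $ p i * (\<Prod>j\<in>UNIV - {i}. ?f p j 0)"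
  have entry: "(?f p i has_field_derivative - B $ i $ p i) (at 0)" for p i
    by (auto intro!: derivative_eq_intros)
  have der: "((\<lambda>t. of_int (sign p) * (\<Prod>i\<in>UNIV. ?f p i t)) has_field_derivative
              of_int (sign p) * ?d p) (at 0)" for p
    by (intro DERIV_cmult has_field_derivative_prod entry)
  have nonid: "?d p = 0" if p: "p permutes (UNIV :: 'n set)" and ne: "p \<noteq> id" for p
  proof -
    obtain a where a: "p a \<noteq> a" using ne by (auto simp: fun_eq_iff)
    have pa: "p (p a) \<noteq> p a" using a p by (metis permutes_inj injD)
    have "(\<Prod>j\<in>UNIV - {i}. ?f p j 0) = 0" for i
    proof (cases "i = a")
      case True
      then have "p a \<in> UNIV - {i}" "?f p (p a) 0 = 0" using a pa by (auto simp: mat_def)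
      then show ?thesis by (intro prod_zero bexI) simp_all
    next
      case False
      then have "a \<in> UNIV - {i}" "?f p a 0 = 0" using a by (auto simp: mat_def)
      then show ?thesis by (intro prod_zero bexI) simp_all
    qed
    then show ?thesis by (simp only: mult_zero_right sum.neutral_const)
  qed
  have "((\<lambda>t. det (mat 1 - t *\<^sub>R B)) has_field_derivative
          (\<Sum>p | p permutes (UNIV :: 'n set). of_int (sign p) * ?d p)) (at 0)"
    unfolding det_def by (intro DERIV_sum der)
  also have "(\<Sum>p | p permutes (UNIV :: 'n set). of_int (sign p) * ?d p) =
             (\<Sum>p\<in>{id}. of_int (sign p) * ?d p)"
  proof (rule sum.mono_neutral_right)
    show "\<forall>p\<in>{p. p permutes UNIV} - {id}. of_int (sign p) * ?d p = 0"
    proof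
      fix p assume "p \<in> {p. p permutes (UNIV :: 'n set)} - {id}"
      then have "?d p = 0" by (intro nonid) auto
      then show "of_int (sign p) * ?d p = 0" by (simp only: mult_zero_right)
    qed
  qed (auto simp: permutes_id)
  also have "\<dots> = - trace B"
    by (simp add: trace_def mat_def sum_negf)
  finally show ?thesis .
qed

lemma trace_inverse_eq_sum_inverse_eigenvalues:
  fixes A B :: "real^'n^'n"
  assumes inv: "B ** A = mat 1"
    and ev: "eigenvalues_with_multiplicity A lam"
  shows "trace B = (\<Sum>j\<in>UNIV. inverse (lam j))"
proof -
  have charpoly: "det (mat t - A) = (\<Prod>j\<in>UNIV. t - lam j)" for t
    using ev by (simp add: eigenvalues_with_multiplicity_def poly_prod flip: poly_charpoly)
  \<comment> \<open>Multiplying by \<open>- B\<close> turns the characteristic polynomial, in which \<open>trace B\<close> is not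
    directly visible, into a perturbation of the identity.\<close>
  have "(- B) ** (mat t - A) = mat 1 - t *\<^sub>R B" for t
  proof -
    have "B ** mat t = t *\<^sub>R B"
      by (simp add: vec_eq_iff matrix_matrix_mult_def mat_def if_distrib if_distribR cong: if_cong)
    moreover have "(- B) ** (mat t - A) = B ** A - B ** mat t"
      by (simp add: vec_eq_iff matrix_matrix_mult_def sum_subtractf algebra_simps sum_negf)
    ultimately show ?thesis using inv by simp
  qed
  then have det_eq: "det (mat 1 - t *\<^sub>R B) = det (- B) * (\<Prod>j\<in>UNIV. t - lam j)" for t
    by (metis det_mul charpoly)
  have at_0: "det (- B) * (\<Prod>j\<in>UNIV. - lam j) = 1"
    using det_eq[of 0] by simp
  then have "(\<Prod>j\<in>UNIV. - lam j) \<noteq> 0" by fastforce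
  then have nz: "lam j \<noteq> 0" for j
    by (subst (asm) prod_zero_iff) auto
  have "det (mat 1 - t *\<^sub>R B) = (\<Prod>j\<in>UNIV. 1 - t * inverse (lam j))" for t
  proof -
    have "(\<Prod>j\<in>UNIV. t - lam j) = (\<Prod>j\<in>UNIV. - lam j * (1 - t * inverse (lam j)))"
      by (rule prod.cong) (use nz in \<open>auto simp: field_simps\<close>)
    also have "\<dots> = (\<Prod>j\<in>UNIV. - lam j) * (\<Prod>j\<in>UNIV. 1 - t * inverse (lam j))"
      by (rule prod.distrib)
    finally show ?thesis
      using at_0 det_eq[of t] by (metis mult.assoc mult_1)
  qed
  then have "((\<lambda>t. \<Prod>j\<in>UNIV. 1 - t * inverse (lam j)) has_field_derivative - trace B) (at 0)"
    using has_field_derivative_det_at_identity[of B] by simp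
  moreover have "((\<lambda>t. \<Prod>j\<in>UNIV. 1 - t * inverse (lam j)) has_field_derivative
      (\<Sum>j\<in>UNIV. - inverse (lam j) * (\<Prod>i\<in>UNIV - {j}. 1 - 0 * inverse (lam i)))) (at 0)"
    by (rule has_field_derivative_prod) (auto intro!: derivative_eq_intros)
  ultimately have "- trace B = (\<Sum>j\<in>UNIV. - inverse (lam j) *
      (\<Prod>i\<in>UNIV - {j}. 1 - 0 * inverse (lam i)))"
    by (rule DERIV_unique)
  then show ?thesis by (simp add: sum_negf)
qed

text \<open>
  The bound holds on average over all signs, because the cross terms cancel. Concretely, the
  signs can be chosen one at a time: each new vector takes the sign for which its inner product
  with the sum so far is not positive.
\<close>

lemma short_signed_sum:
  fixes v :: "'i \<Rightarrow> 'a::real_inner"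
  assumes "finite J"
  shows "\<exists>e :: 'i \<Rightarrow> real. (\<forall>j. \<bar>e j\<bar> = 1) \<and>
           (norm (\<Sum>j\<in>J. e j *\<^sub>R v j))\<^sup>2 \<le> (\<Sum>j\<in>J. (norm (v j))\<^sup>2)"
  using assms
proof (induction J rule: finite_induct)
  case empty
  show ?case by (rule exI[of _ "\<lambda>_. 1"]) simp
next
  case (insert k J)
  then obtain e :: "'i \<Rightarrow> real" where e: "\<And>j. \<bar>e j\<bar> = 1"
    and le: "(norm (\<Sum>j\<in>J. e j *\<^sub>R v j))\<^sup>2 \<le> (\<Sum>j\<in>J. (norm (v j))\<^sup>2)"
    by blast
  define s where "s = (\<Sum>j\<in>J. e j *\<^sub>R v j)"
  define c :: real where "c = (if s \<bullet> v k \<le> 0 then 1 else - 1)"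
  have c: "\<bar>c\<bar> = 1" "c * (s \<bullet> v k) \<le> 0" by (auto simp: c_def)
  have cc: "c\<^sup>2 = 1" by (simp add: c_def)
  have "(norm (c *\<^sub>R v k + s))\<^sup>2 = c\<^sup>2 * (norm (v k))\<^sup>2 + (norm s)\<^sup>2 + 2 * (c * (s \<bullet> v k))"
    unfolding power2_norm_eq_inner
    by (simp add: inner_add_left inner_add_right inner_commute power2_eq_square)
  then have *: "(norm (c *\<^sub>R v k + s))\<^sup>2 \<le> (norm (v k))\<^sup>2 + (norm s)\<^sup>2"
    using c(2) cc by simp
  have "(\<Sum>j\<in>J. (e(k := c)) j *\<^sub>R v j) = s"
    unfolding s_def by (rule sum.cong) (use insert.hyps in auto)
  then have "(\<Sum>j\<in>insert k J. (e(k := c)) j *\<^sub>R v j) = c *\<^sub>R v k + s"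
    using insert.hyps by simp
  then have "(norm (\<Sum>j\<in>insert k J. (e(k := c)) j *\<^sub>R v j))\<^sup>2
      \<le> (\<Sum>j\<in>insert k J. (norm (v j))\<^sup>2)"
    using * le insert.hyps by (simp add: s_def)
  moreover have "\<forall>j. \<bar>(e(k := c)) j\<bar> = 1" using e c by simp
  ultimately show ?case by blast
qed

lemma sum_norm_columns_eq_trace:
  fixes Y :: "real^'n^'m"
  shows "(\<Sum>j\<in>UNIV. (norm (column j Y))\<^sup>2) = trace (transpose Y ** Y)"
  by (simp add: power2_norm_eq_inner inner_vec_def trace_def matrix_matrix_mult_def
      transpose_def column_def)

lemma attains_max_prod_on_sphere:
  fixes X :: "real^'n^'n"
  shows "\<exists>y. norm y = 1 \<and> (\<forall>z. norm z = 1 \<longrightarrow>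
           (\<Prod>j\<in>UNIV. \<bar>(X *v z) $ j\<bar>) \<le> (\<Prod>j\<in>UNIV. \<bar>(X *v y) $ j\<bar>))"
proof -
  have "continuous_on (sphere 0 1) (\<lambda>y. \<Prod>j\<in>UNIV. \<bar>(X *v y) $ j\<bar>)"
    by (intro continuous_intros matrix_vector_mult_linear_continuous_on)
  moreover have "compact (sphere (0 :: real^'n) 1)" "sphere (0 :: real^'n) 1 \<noteq> {}"
    by auto
  ultimately obtain y where "y \<in> sphere 0 1"
    "\<forall>z\<in>sphere 0 1. (\<Prod>j\<in>UNIV. \<bar>(X *v z) $ j\<bar>) \<le> (\<Prod>j\<in>UNIV. \<bar>(X *v y) $ j\<bar>)"
    using continuous_attains_sup by blast
  then show ?thesis by (auto simp: dist_norm)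
qed

lemma invertible_if_rows_independent:
  fixes X :: "real^'n^'n"
  assumes "inj x" "independent (range x)" "\<And>j. row j X = x j"
  obtains Y where "X ** Y = mat 1" "Y ** X = mat 1"
proof -
  have "\<forall>i. c i = 0" if z: "(\<Sum>i\<in>UNIV. c i *s row i X) = 0" for c :: "'n \<Rightarrow> real"
  proof
    fix i
    have "(\<Sum>v\<in>range x. c (the_inv x v) *\<^sub>R v) = (\<Sum>i\<in>UNIV. c (the_inv x (x i)) *\<^sub>R x i)"
      by (rule sum.reindex_cong[OF assms(1)]) auto
    also have "\<dots> = 0"
      using z assms(1,3) by (simp add: the_inv_f_f scalar_mult_eq_scaleR)
    finally have "c (the_inv x (x i)) = 0"
      using independentD[OF assms(2), of "range x" "\<lambda>v. c (the_inv x v)" "x i"] by simp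
    then show "c i = 0" using assms(1) by (simp add: the_inv_f_f)
  qed
  then obtain Y where "X ** Y = mat 1"
    using matrix_right_invertible_independent_rows[of X] by blast
  then show thesis using that matrix_left_right_inverse by blast
qed

text \<open>
  The witness is the normalised preimage under \<open>X\<close> of a sign vector, with the signs chosen to
  make this preimage short.
\<close>

lemma unit_vector_with_large_product:
  fixes X Y :: "real^'n^'n"
  assumes inv: "X ** Y = mat 1"
  shows "\<exists>y. norm y = 1 \<and>
           (\<Prod>j\<in>UNIV. \<bar>(X *v y) $ j\<bar>) \<ge> trace (transpose Y ** Y) powr (- (real CARD('n) / 2))"
proof -
  let ?S = "trace (transpose Y ** Y)"
  obtain e :: "'n \<Rightarrow> real" where e: "\<And>j. \<bar>e j\<bar> = 1"
    and short: "(norm (\<Sum>j\<in>UNIV. e j *\<^sub>R column j Y))\<^sup>2 \<le> ?S"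
    using short_signed_sum[of "UNIV :: 'n set" "\<lambda>j. column j Y"]
    unfolding sum_norm_columns_eq_trace by auto
  define u where "u = Y *v (\<chi> j. e j)"
  have u_sum: "u = (\<Sum>j\<in>UNIV. e j *\<^sub>R column j Y)"
    by (simp add: u_def matrix_mult_sum scalar_mult_eq_scaleR)
  have Xu: "X *v u = (\<chi> j. e j)"
    by (simp add: u_def matrix_vector_mul_assoc inv)
  have "u \<noteq> 0"
  proof
    assume "u = 0"
    then have "e j = 0" for j using arg_cong[OF Xu, of "\<lambda>v. v $ j"] by simp
    then show False using e by (metis abs_zero zero_neq_one)
  qed
  then have pos: "norm u > 0" by simp
  define y where "y = (1 / norm u) *\<^sub>R u"
  have "(X *v y) $ j = e j / norm u" for j
    by (simp add: y_def matrix_vector_mult_scaleR Xu)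
  then have "(\<Prod>j\<in>UNIV. \<bar>(X *v y) $ j\<bar>) = (1 / norm u) ^ CARD('n)"
    using e by (simp add: abs_divide)
  also have "\<dots> = ((norm u)\<^sup>2) powr (- (real CARD('n) / 2))"
    using pos by (simp add: powr_minus powr_powr powr_realpow power_one_over inverse_eq_divide
        flip: powr_numeral)
  also have "\<dots> \<ge> ?S powr (- (real CARD('n) / 2))"
    using short pos by (intro powr_mono2') (auto simp: u_sum)
  finally have "(\<Prod>j\<in>UNIV. \<bar>(X *v y) $ j\<bar>) \<ge> ?S powr (- (real CARD('n) / 2))" .
  moreover have "norm y = 1" using pos by (simp add: y_def)
  ultimately show ?thesis by blast
qed

theorem corollary2p3:
  fixes x :: "'n::finite \<Rightarrow> real^'n" and X :: "real^'n^'n" and lam :: "'n \<Rightarrow> real"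
  assumes unit: "\<And>j. norm (x j) = 1"
    and indep: "inj x" "independent (range x)"
    and X_rows: "\<And>j. row j X = x j"
    and lam: "eigenvalues_with_multiplicity (X ** transpose X) lam"
  shows "\<exists>y. norm y = 1
           \<and> (\<forall>z. norm z = 1 \<longrightarrow> (\<Prod>j\<in>UNIV. \<bar>(X *v z) $ j\<bar>) \<le> (\<Prod>j\<in>UNIV. \<bar>(X *v y) $ j\<bar>))
           \<and> (\<Prod>j\<in>UNIV. \<bar>(X *v y) $ j\<bar>)
               \<ge> (real CARD('n) / (\<Sum>j\<in>UNIV. inverse (lam j))) powr (real CARD('n) / 2)
                 * real CARD('n) powr (- (real CARD('n) / 2))"
proof -
  obtain Y where Y: "X ** Y = mat 1" "Y ** X = mat 1"
    using invertible_if_rows_independent[OF indep X_rows] by blast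
  define S where "S = (\<Sum>j\<in>UNIV. inverse (lam j))"
  have "(transpose Y ** Y) ** (X ** transpose X) = transpose Y ** (Y ** X) ** transpose X"
    by (simp add: matrix_mul_assoc)
  also have "\<dots> = transpose (X ** Y)"
    by (simp add: Y(2) matrix_transpose_mul)
  finally have "(transpose Y ** Y) ** (X ** transpose X) = mat 1"
    by (simp add: Y(1) transpose_mat)
  then have trace: "trace (transpose Y ** Y) = S"
    unfolding S_def using lam by (rule trace_inverse_eq_sum_inverse_eigenvalues)
  have S_nonneg: "S \<ge> 0"
    unfolding trace[symmetric] sum_norm_columns_eq_trace[symmetric] by (simp add: sum_nonneg)
  have bound: "(real CARD('n) / S) powr (real CARD('n) / 2)
      * real CARD('n) powr (- (real CARD('n) / 2)) = S powr (- (real CARD('n) / 2))"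
    using S_nonneg by (simp add: powr_divide powr_minus field_simps)
  obtain y where y: "norm y = 1"
    "\<And>z. norm z = 1 \<Longrightarrow> (\<Prod>j\<in>UNIV. \<bar>(X *v z) $ j\<bar>) \<le> (\<Prod>j\<in>UNIV. \<bar>(X *v y) $ j\<bar>)"
    using attains_max_prod_on_sphere by blast
  obtain w where w: "norm w = 1"
    "(\<Prod>j\<in>UNIV. \<bar>(X *v w) $ j\<bar>) \<ge> S powr (- (real CARD('n) / 2))"
    using unit_vector_with_large_product[OF Y(1)] trace by auto
  have "(\<Prod>j\<in>UNIV. \<bar>(X *v y) $ j\<bar>) \<ge> S powr (- (real CARD('n) / 2))"
    using y(2)[OF w(1)] w(2) by linarith
  then show ?thesis
    using y bound unfolding S_def by auto
qed

end
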